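(* Let $\mathscr{H}_1,\mathscr{H}_2$ be Hilbert spaces, $n\ge1$, let $T_i=\begin{bmatrix}A_i&B_i\\C_i&D_i\end{bmatrix}\in\mathbb{B}(\mathscr{H}_1\oplus\mathscr{H}_2)$ for $1\le i\le n$, and let $p\ge1$. Then $$\omega_p^p(T_1,\ldots,T_n)\leq 2^{-p}\sum_{i=1}^n\left(\omega(A_i)+\omega(D_i)+\sqrt{\left(\omega(A_i)-\omega(D_i)\right)^2+\left(\|B_i\|+\|C_i\|\right)^2}\right)^p.$$ In particular, for every $\begin{bmatrix}A&B\\C&D\end{bmatrix}\in\mathbb{B}(\mathscr{H}_1\oplus\mathscr{H}_2)$, $$\omega\left(\begin{bmatrix}A&B\\C&D\end{bmatrix}\right)\leq\frac12\left(\omega(A)+\omega(D)+\sqrt{\left(\omega(A)-\omega(D)\right)^2+\left(\|B\|+\|C\|\right)^2}\right).$$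
   Context: Hilbert spaces are complex. $\mathbb{B}(\mathscr{K},\mathscr{L})$ is the space of bounded linear operators from $\mathscr{K}$ to $\mathscr{L}$, and $\mathbb{B}(\mathscr{K})=\mathbb{B}(\mathscr{K},\mathscr{K})$. In an operator matrix on $\mathscr{H}_1\oplus\mathscr{H}_2$ the $(i,j)$ entry lies in $\mathbb{B}(\mathscr{H}_j,\mathscr{H}_i)$. The numerical radius of $T\in\mathbb{B}(\mathscr{K})$ is $\omega(T)=\sup\{|\langle Tx,x\rangle| : \|x\|=1\}$. For $T_1,\ldots,T_n\in\mathbb{B}(\mathscr{K})$ and $p\ge1$, $\omega_p(T_1,\ldots,T_n)=\sup_{\|x\|=1}\left(\sum_{i=1}^n|\langle T_ix,x\rangle|^p\right)^{1/p}$, and $\omega_p^p$ denotes its $p$-th power. $\|\cdot\|$ is the operator norm. *)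

theory Defs
  imports "HOL-Analysis.Analysis"
begin

class complex_vector = real_vector +
  fixes scaleC :: "complex \<Rightarrow> 'a \<Rightarrow> 'a"  (infixr "*\<^sub>C" 75)
  assumes scaleC_add_right: "c *\<^sub>C (x + y) = c *\<^sub>C x + c *\<^sub>C y"
    and scaleC_add_left: "(c + d) *\<^sub>C x = c *\<^sub>C x + d *\<^sub>C x"
    and scaleC_scaleC: "c *\<^sub>C (d *\<^sub>C x) = (c * d) *\<^sub>C x"
    and scaleC_of_real: "complex_of_real r *\<^sub>C x = r *\<^sub>R x"

lemma scaleC_zero: "c *\<^sub>C (0::'a::complex_vector) = 0"
  using scaleC_add_right[of c 0 "0::'a"] by simp

text \<open>The inner product is linear in its first argument. The last axiom says that the norm
  is the one induced by the inner product; since \<^term>\<open>norm\<close> is a norm, it also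
  gives positive definiteness.\<close>

class complex_inner = complex_vector + real_normed_vector +
  fixes cinner :: "'a \<Rightarrow> 'a \<Rightarrow> complex"
  assumes cinner_commute: "cinner x y = cnj (cinner y x)"
    and cinner_add_left: "cinner (x + y) z = cinner x z + cinner y z"
    and cinner_scaleC_left: "cinner (c *\<^sub>C x) y = c * cinner x y"
    and cinner_self: "cinner x x = complex_of_real ((norm x)\<^sup>2)"

class complex_hilbert_space = complex_inner + complete_space

text \<open>The Hilbert space direct sum is the product type: its norm in \<open>HOL-Analysis\<close>
  is already the square root of the sum of the squared norms.\<close>

instantiation prod :: (complex_vector, complex_vector) complex_vector
begin

definition scaleC_prod_def: "c *\<^sub>C u = (c *\<^sub>C fst u, c *\<^sub>C snd u)"

instance
  by standard
    (simp_all add: scaleC_prod_def scaleC_add_right scaleC_add_left scaleC_scaleC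
      scaleC_of_real prod_eq_iff)

end

instantiation prod :: (complex_inner, complex_inner) complex_inner
begin

definition cinner_prod_def: "cinner u v = cinner (fst u) (fst v) + cinner (snd u) (snd v)"

instance
proof
  fix u v w :: "'a \<times> 'b" and c :: complex
  show "cinner u v = cnj (cinner v u)"
    unfolding cinner_prod_def complex_cnj_add
    by (rule arg_cong2[where f = "(+)"]) (rule cinner_commute)+
  show "cinner (u + v) w = cinner u w + cinner v w"
    by (simp add: cinner_prod_def cinner_add_left)
  show "cinner (c *\<^sub>C u) v = c * cinner u v"
    by (simp add: cinner_prod_def scaleC_prod_def cinner_scaleC_left algebra_simps)
  show "cinner u u = complex_of_real ((norm u)\<^sup>2)"
    by (simp add: cinner_prod_def norm_prod_def cinner_self)
qed

end

instance prod :: (complex_hilbert_space, complex_hilbert_space) complex_hilbert_space ..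

definition bounded_clinear ::
    "('a::{complex_vector,real_normed_vector} \<Rightarrow> 'b::{complex_vector,real_normed_vector}) \<Rightarrow> bool"
  where "bounded_clinear T \<longleftrightarrow> bounded_linear T \<and> (\<forall>c x. T (c *\<^sub>C x) = c *\<^sub>C T x)"

definition op_matrix ::
    "('a \<Rightarrow> 'a) \<Rightarrow> ('b \<Rightarrow> 'a) \<Rightarrow> ('a \<Rightarrow> 'b) \<Rightarrow> ('b \<Rightarrow> 'b)
      \<Rightarrow> 'a::complex_hilbert_space \<times> 'b::complex_hilbert_space \<Rightarrow> 'a \<times> 'b"
  where "op_matrix A B C D = (\<lambda>(x, y). (A x + B y, C x + D y))"

text \<open>The suprema are taken in the nonnegative reals: inserting 0 only matters for the zero
  space, which has no unit vectors and where the supremum is then 0.\<close>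

definition numerical_radius :: "('a::complex_hilbert_space \<Rightarrow> 'a) \<Rightarrow> real"
  where "numerical_radius T = Sup (insert 0 {cmod (cinner (T x) x) |x. norm x = 1})"

definition joint_numerical_radius ::
    "real \<Rightarrow> nat \<Rightarrow> (nat \<Rightarrow> 'a::complex_hilbert_space \<Rightarrow> 'a) \<Rightarrow> real"
  where "joint_numerical_radius p n T =
    Sup (insert 0 {(\<Sum>i = 1..n. cmod (cinner (T i x) x) powr p) powr (1 / p) |x. norm x = 1})"

text \<open>The operator matrices with bounded entries are exactly the bounded operators on the
  direct sum.\<close>

lemma bounded_clinear_op_matrix:
  assumes "bounded_clinear A" "bounded_clinear B" "bounded_clinear C" "bounded_clinear D"
  shows "bounded_clinear (op_matrix A B C D)"
proof -
  have "bounded_linear (\<lambda>u. (A (fst u) + B (snd u), C (fst u) + D (snd u)))"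
    using assms unfolding bounded_clinear_def
    by (intro bounded_linear_Pair bounded_linear_add
        bounded_linear_compose[OF _ bounded_linear_fst] bounded_linear_compose[OF _ bounded_linear_snd])
      simp_all
  moreover have "op_matrix A B C D = (\<lambda>u. (A (fst u) + B (snd u), C (fst u) + D (snd u)))"
    by (auto simp: op_matrix_def fun_eq_iff)
  ultimately show ?thesis
    using assms by (simp add: bounded_clinear_def scaleC_prod_def scaleC_add_right)
qed

lemma bounded_clinear_eq_op_matrix:
  assumes "bounded_clinear T"
  obtains A B C D where "bounded_clinear A" "bounded_clinear B"
    "bounded_clinear C" "bounded_clinear D" "T = op_matrix A B C D"
proof
  have T: "bounded_linear T" and Tc: "\<And>c u. T (c *\<^sub>C u) = c *\<^sub>C T u"
    using assms by (auto simp: bounded_clinear_def)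
  have l: "bounded_linear (\<lambda>x. T (x, 0))" and r: "bounded_linear (\<lambda>y. T (0, y))"
    by (intro bounded_linear_compose[OF T] bounded_linear_Pair bounded_linear_ident
        bounded_linear_zero)+
  have lc: "T (c *\<^sub>C x, 0) = c *\<^sub>C T (x, 0)" and rc: "T (0, c *\<^sub>C y) = c *\<^sub>C T (0, y)" for c x y
    using Tc[of c "(x, 0)"] Tc[of c "(0, y)"] by (simp_all add: scaleC_prod_def scaleC_zero)
  show "bounded_clinear (\<lambda>x. fst (T (x, 0)))" "bounded_clinear (\<lambda>y. fst (T (0, y)))"
    "bounded_clinear (\<lambda>x. snd (T (x, 0)))" "bounded_clinear (\<lambda>y. snd (T (0, y)))"
    using bounded_linear_compose[OF bounded_linear_fst l] bounded_linear_compose[OF bounded_linear_fst r]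
      bounded_linear_compose[OF bounded_linear_snd l] bounded_linear_compose[OF bounded_linear_snd r]
    unfolding bounded_clinear_def by (auto simp: lc rc scaleC_prod_def)
  show "T = op_matrix (\<lambda>x. fst (T (x, 0))) (\<lambda>y. fst (T (0, y)))
      (\<lambda>x. snd (T (x, 0))) (\<lambda>y. snd (T (0, y)))" (is "_ = ?M")
  proof (rule ext, clarify)
    fix x y
    have "T (x, y) = T (x, 0) + T (0, y)"
      using linear_add[OF bounded_linear.linear[OF T], of "(x, 0)" "(0, y)"] by simp
    then show "T (x, y) = ?M (x, y)"
      by (simp add: op_matrix_def prod_eq_iff)
  qed
qed

end

theory Submission
  imports Defs
begin

text \<open>
  For a unit vector \<open>u = (x, y)\<close> put \<open>a = norm x\<close> and \<open>b = norm y\<close>, so that \<open>a\<^sup>2 + b\<^sup>2 = 1\<close>.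
  Expanding \<open>\<langle>T u, u\<rangle>\<close> for an operator matrix \<open>T\<close> gives four terms. The diagonal ones are
  controlled by numerical radii, which scale quadratically, and the off-diagonal ones by
  Cauchy-Schwarz and operator norms, whence
  \<open>\<bar>\<langle>T u, u\<rangle>\<bar> \<le> \<omega>(A) a\<^sup>2 + (\<parallel>B\<parallel> + \<parallel>C\<parallel>) a b + \<omega>(D) b\<^sup>2\<close>.
  The right side is a real quadratic form on the unit circle, so it is at most the larger
  eigenvalue of its symmetric \<open>2 \<times> 2\<close> matrix, and this eigenvalue is
  \<open>(\<omega>(A) + \<omega>(D) + sqrt ((\<omega>(A) - \<omega>(D))\<^sup>2 + (\<parallel>B\<parallel> + \<parallel>C\<parallel>)\<^sup>2)) / 2\<close>
  (lemma \<open>cmod_cinner_op_matrix_le\<close>).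

  This bound does not depend on \<open>u\<close>. Taking the supremum gives the inequality for a single
  operator; summing \<open>p\<close>-th powers first and then taking the supremum gives the one for the
  joint numerical radius.
\<close>

lemma cinner_add_right:
  "cinner x (y + z) = cinner x y + cinner x (z::'a::complex_inner)"
  by (metis cinner_commute cinner_add_left complex_cnj_add)

lemma cinner_scaleC_right:
  "cinner x (c *\<^sub>C y) = cnj c * cinner x (y::'a::complex_inner)"
  by (metis cinner_commute cinner_scaleC_left complex_cnj_mult)

lemma norm_scaleC: "norm (c *\<^sub>C x) = cmod c * norm (x::'a::complex_inner)"
proof -
  have "complex_of_real ((norm (c *\<^sub>C x))\<^sup>2) = (c * cnj c) * cinner x x"
    by (simp only: cinner_self[symmetric] cinner_scaleC_left cinner_scaleC_right mult_ac)
  also have "\<dots> = complex_of_real ((cmod c * norm x)\<^sup>2)"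
    by (simp only: cinner_self complex_norm_square[symmetric] power_mult_distrib of_real_mult)
  finally have "(norm (c *\<^sub>C x))\<^sup>2 = (cmod c * norm x)\<^sup>2"
    using of_real_eq_iff by blast
  then show ?thesis
    by simp
qed

text \<open>The triangle inequality is an axiom for the norm, and squaring it already yields the
  Cauchy-Schwarz inequality for the real part.\<close>

lemma Re_cinner_le: "Re (cinner x y) \<le> norm x * norm (y::'a::complex_inner)"
proof -
  have norm_sq: "(norm z)\<^sup>2 = Re (cinner z z)" for z :: 'a
    by (simp only: cinner_self Re_complex_of_real)
  have "(norm (x + y))\<^sup>2 = (norm x)\<^sup>2 + (norm y)\<^sup>2 + Re (cinner x y) + Re (cinner y x)"
    unfolding norm_sq by (simp add: cinner_add_left cinner_add_right)
  moreover have "Re (cinner y x) = Re (cinner x y)"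
    by (subst cinner_commute) simp
  ultimately have "(norm (x + y))\<^sup>2 = (norm x)\<^sup>2 + (norm y)\<^sup>2 + 2 * Re (cinner x y)"
    by simp
  moreover have "(norm (x + y))\<^sup>2 \<le> (norm x + norm y)\<^sup>2"
    by (simp add: norm_triangle_ineq power_mono)
  ultimately show ?thesis
    by (simp add: power2_sum)
qed

text \<open>The modulus reduces to the real part by rotating \<open>x\<close> with a phase that makes the inner
  product real and nonnegative.\<close>

lemma cmod_cinner_le: "cmod (cinner x y) \<le> norm x * norm (y::'a::complex_inner)"
proof (cases "cinner x y = 0")
  case False
  define c where "c = cnj (sgn (cinner x y))"
  have c: "cmod c = 1"
    using False by (simp add: c_def norm_sgn)
  have "c * cinner x y = complex_of_real (cmod (cinner x y))"
    using False
    by (simp add: c_def sgn_eq complex_norm_square[symmetric] mult.commute power2_eq_square)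
  then have "cmod (cinner x y) = Re (cinner (c *\<^sub>C x) y)"
    by (simp add: cinner_scaleC_left)
  also have "\<dots> \<le> norm x * norm y"
    using Re_cinner_le[of "c *\<^sub>C x" y] c by (simp add: norm_scaleC)
  finally show ?thesis .
qed simp

text \<open>Boundedness makes the supremum in the numerical radius a genuine one, so that it bounds
  the values on unit vectors.\<close>

lemma numerical_radius_bdd_above:
  assumes "bounded_linear T"
  shows "bdd_above (insert 0 {cmod (cinner (T x) x) |x::'a::complex_hilbert_space. norm x = 1})"
proof -
  have "cmod (cinner (T x) x) \<le> onorm T" if "norm x = 1" for x
    using cmod_cinner_le[of "T x" x] onorm[OF assms, of x] that by simp
  then have "bdd_above {cmod (cinner (T x) x) |x. norm x = 1}"
    by (intro bdd_aboveI) blast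
  then show ?thesis
    by simp
qed

lemma numerical_radius_nonneg: "bounded_linear T \<Longrightarrow> 0 \<le> numerical_radius T"
  unfolding numerical_radius_def by (rule cSup_upper[OF _ numerical_radius_bdd_above]) auto

lemma numerical_radius_le:
  assumes "0 \<le> K" and "\<And>x. norm x = 1 \<Longrightarrow> cmod (cinner (T x) x) \<le> K"
  shows "numerical_radius T \<le> K"
  unfolding numerical_radius_def by (rule cSup_least) (use assms in auto)

text \<open>Both sides are quadratic in \<open>x\<close>, so normalising \<open>x\<close> extends the defining bound from unit
  vectors to all vectors.\<close>

lemma cmod_cinner_le_numerical_radius:
  assumes T: "bounded_clinear T"
  shows "cmod (cinner (T x) x) \<le> numerical_radius T * (norm (x::'a::complex_hilbert_space))\<^sup>2"
proof (cases "x = 0")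
  case True
  then show ?thesis
    using cmod_cinner_le[of "T x" x] by simp
next
  case False
  have bl: "bounded_linear T"
    using T by (simp add: bounded_clinear_def)
  define r where "r = complex_of_real (norm x)"
  define u where "u = inverse (norm x) *\<^sub>R x"
  have u: "norm u = 1"
    using False by (simp add: u_def)
  have x: "x = r *\<^sub>C u"
    using False by (simp add: r_def u_def scaleC_of_real)
  have "cinner (T x) x = r * cnj r * cinner (T u) u"
    using T unfolding x by (simp add: bounded_clinear_def cinner_scaleC_left cinner_scaleC_right)
  then have "cmod (cinner (T x) x) = (norm x)\<^sup>2 * cmod (cinner (T u) u)"
    by (simp add: r_def norm_mult power2_eq_square)
  moreover have "cmod (cinner (T u) u) \<le> numerical_radius T"
    unfolding numerical_radius_def
    by (rule cSup_upper[OF _ numerical_radius_bdd_above[OF bl]]) (use u in auto)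
  ultimately show ?thesis
    by (simp add: mult.commute mult_right_mono)
qed

text \<open>This is the Rayleigh bound for the symmetric matrix with diagonal entries \<open>\<alpha>\<close>, \<open>\<delta>\<close> and
  off-diagonal entries \<open>m / 2\<close>. With \<open>a = cos \<theta>\<close> and \<open>b = sin \<theta>\<close> the form equals
  \<open>((\<alpha> + \<delta>) + (\<alpha> - \<delta>) cos (2\<theta>) + m sin (2\<theta>)) / 2\<close>, and the last two summands are an inner
  product with a unit vector.\<close>

lemma quadratic_form_unit_circle_le:
  fixes a b \<alpha> \<delta> m :: real
  assumes ab: "a\<^sup>2 + b\<^sup>2 = 1"
  shows "\<alpha> * a\<^sup>2 + m * (a * b) + \<delta> * b\<^sup>2 \<le> 1 / 2 * (\<alpha> + \<delta> + sqrt ((\<alpha> - \<delta>)\<^sup>2 + m\<^sup>2))"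
proof -
  define P Q where "P = a\<^sup>2 - b\<^sup>2" and "Q = 2 * (a * b)"
  have "P\<^sup>2 + Q\<^sup>2 = (a\<^sup>2 + b\<^sup>2)\<^sup>2"
    by (simp add: P_def Q_def power2_eq_square algebra_simps)
  then have PQ: "P\<^sup>2 + Q\<^sup>2 = 1"
    using ab by simp
  have "((\<alpha> - \<delta>) * P + m * Q)\<^sup>2 + ((\<alpha> - \<delta>) * Q - m * P)\<^sup>2 = ((\<alpha> - \<delta>)\<^sup>2 + m\<^sup>2) * (P\<^sup>2 + Q\<^sup>2)"
    by (simp add: power2_eq_square algebra_simps)
  then have "((\<alpha> - \<delta>) * P + m * Q)\<^sup>2 \<le> (\<alpha> - \<delta>)\<^sup>2 + m\<^sup>2"
    using PQ by (smt (verit) mult_cancel_left1 zero_le_power2 mult.right_neutral)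
  then have "(\<alpha> - \<delta>) * P + m * Q \<le> sqrt ((\<alpha> - \<delta>)\<^sup>2 + m\<^sup>2)"
    by (rule real_le_rsqrt)
  moreover have "2 * (\<alpha> * a\<^sup>2 + m * (a * b) + \<delta> * b\<^sup>2)
      = (\<alpha> + \<delta>) * (a\<^sup>2 + b\<^sup>2) + ((\<alpha> - \<delta>) * P + m * Q)"
    by (simp add: P_def Q_def algebra_simps)
  ultimately show ?thesis
    using ab by simp
qed

lemma cmod_cinner_op_matrix_le:
  fixes A :: "'a::complex_hilbert_space \<Rightarrow> 'a" and D :: "'b::complex_hilbert_space \<Rightarrow> 'b"
  assumes A: "bounded_clinear A" and B: "bounded_clinear B"
    and C: "bounded_clinear C" and D: "bounded_clinear D"
    and u: "norm u = 1"
  shows "cmod (cinner (op_matrix A B C D u) u) \<le>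
    1 / 2 * (numerical_radius A + numerical_radius D
      + sqrt ((numerical_radius A - numerical_radius D)\<^sup>2 + (onorm B + onorm C)\<^sup>2))"
proof -
  obtain x y where xy: "u = (x, y)"
    by (cases u)
  have sq: "(norm x)\<^sup>2 + (norm y)\<^sup>2 = 1"
    using u by (simp add: xy norm_prod_def)
  have "cinner (op_matrix A B C D u) u
      = cinner (A x) x + cinner (B y) x + cinner (C x) y + cinner (D y) y"
    by (simp add: xy op_matrix_def cinner_prod_def cinner_add_left)
  then have "cmod (cinner (op_matrix A B C D u) u)
      \<le> cmod (cinner (A x) x) + cmod (cinner (B y) x) + cmod (cinner (C x) y) + cmod (cinner (D y) y)"
    by (smt (verit) norm_triangle_ineq)
  moreover have "cmod (cinner (A x) x) \<le> numerical_radius A * (norm x)\<^sup>2"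
    "cmod (cinner (D y) y) \<le> numerical_radius D * (norm y)\<^sup>2"
    using A D by (auto intro: cmod_cinner_le_numerical_radius)
  moreover have "cmod (cinner (B y) x) \<le> onorm B * norm y * norm x"
    using B by (intro order.trans[OF cmod_cinner_le] mult_right_mono onorm)
      (auto simp: bounded_clinear_def)
  moreover have "cmod (cinner (C x) y) \<le> onorm C * norm x * norm y"
    using C by (intro order.trans[OF cmod_cinner_le] mult_right_mono onorm)
      (auto simp: bounded_clinear_def)
  ultimately have "cmod (cinner (op_matrix A B C D u) u)
      \<le> numerical_radius A * (norm x)\<^sup>2 + (onorm B + onorm C) * (norm x * norm y)
        + numerical_radius D * (norm y)\<^sup>2"
    by (simp add: algebra_simps)
  also have "\<dots> \<le> 1 / 2 * (numerical_radius A + numerical_radius D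
      + sqrt ((numerical_radius A - numerical_radius D)\<^sup>2 + (onorm B + onorm C)\<^sup>2))"
    by (rule quadratic_form_unit_circle_le[OF sq])
  finally show ?thesis .
qed

text \<open>The constants do not depend on the vector, so the \<open>p\<close>-th powers of the individual bounds
  may be summed at each unit vector before the supremum is taken. Since \<open>t \<mapsto> t powr (1 / p)\<close> is
  increasing, the outer \<open>p\<close>-th power then undoes the root.\<close>

lemma joint_numerical_radius_powr_le:
  fixes T :: "nat \<Rightarrow> 'a::complex_hilbert_space \<Rightarrow> 'a"
  assumes p: "p \<ge> 1"
    and K: "\<And>i x. i \<in> {1..n} \<Longrightarrow> norm x = 1 \<Longrightarrow> cmod (cinner (T i x) x) \<le> K i"
  shows "joint_numerical_radius p n T powr p \<le> (\<Sum>i = 1..n. K i powr p)"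
proof -
  define S where "S = insert 0
    {(\<Sum>i = 1..n. cmod (cinner (T i x) x) powr p) powr (1 / p) |x. norm x = 1}"
  define R where "R = (\<Sum>i = 1..n. K i powr p)"
  have R: "0 \<le> R"
    by (simp add: R_def sum_nonneg)
  have sum_le: "(\<Sum>i = 1..n. cmod (cinner (T i x) x) powr p) \<le> R" if "norm x = 1" for x
    unfolding R_def using p K that by (intro sum_mono powr_mono2) auto
  have upper: "s \<le> R powr (1 / p)" if "s \<in> S" for s
    using that p sum_le unfolding S_def by (auto intro!: powr_mono2 sum_nonneg simp del: One_nat_def)
  have "Sup S \<le> R powr (1 / p)"
    using upper by (intro cSup_least) (auto simp: S_def)
  moreover have "0 \<le> Sup S"
    by (rule cSup_upper[OF _ bdd_aboveI[OF upper]]) (auto simp: S_def)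
  ultimately have "Sup S powr p \<le> (R powr (1 / p)) powr p"
    using p by (intro powr_mono2) auto
  also have "\<dots> = R"
    using p R by (simp add: powr_powr)
  finally show ?thesis
    by (simp add: joint_numerical_radius_def S_def R_def)
qed

theorem theorem3p4:
  fixes A :: "nat \<Rightarrow> 'a::complex_hilbert_space \<Rightarrow> 'a"
    and B :: "nat \<Rightarrow> 'b::complex_hilbert_space \<Rightarrow> 'a"
    and C :: "nat \<Rightarrow> 'a \<Rightarrow> 'b"
    and D :: "nat \<Rightarrow> 'b \<Rightarrow> 'b"
    and T :: "nat \<Rightarrow> 'a \<times> 'b \<Rightarrow> 'a \<times> 'b"
    and n :: nat and p :: real
  assumes "n \<ge> 1" and "p \<ge> 1"
    and "\<And>i. i \<in> {1..n} \<Longrightarrow> bounded_clinear (A i)"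
    and "\<And>i. i \<in> {1..n} \<Longrightarrow> bounded_clinear (B i)"
    and "\<And>i. i \<in> {1..n} \<Longrightarrow> bounded_clinear (C i)"
    and "\<And>i. i \<in> {1..n} \<Longrightarrow> bounded_clinear (D i)"
    and "\<And>i. i \<in> {1..n} \<Longrightarrow> T i = op_matrix (A i) (B i) (C i) (D i)"
  shows "joint_numerical_radius p n T powr p \<le>
      2 powr (- p) * (\<Sum>i = 1..n.
        (numerical_radius (A i) + numerical_radius (D i)
          + sqrt ((numerical_radius (A i) - numerical_radius (D i))\<^sup>2
                  + (onorm (B i) + onorm (C i))\<^sup>2)) powr p)
    \<and> (\<forall>(A' :: 'a \<Rightarrow> 'a) (B' :: 'b \<Rightarrow> 'a) (C' :: 'a \<Rightarrow> 'b) (D' :: 'b \<Rightarrow> 'b).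
        bounded_clinear A' \<longrightarrow> bounded_clinear B' \<longrightarrow> bounded_clinear C' \<longrightarrow> bounded_clinear D' \<longrightarrow>
        numerical_radius (op_matrix A' B' C' D') \<le>
          1 / 2 * (numerical_radius A' + numerical_radius D'
            + sqrt ((numerical_radius A' - numerical_radius D')\<^sup>2
                    + (onorm B' + onorm C')\<^sup>2)))"
proof (intro conjI allI impI)
  define L where "L i = numerical_radius (A i) + numerical_radius (D i)
    + sqrt ((numerical_radius (A i) - numerical_radius (D i))\<^sup>2 + (onorm (B i) + onorm (C i))\<^sup>2)" for i
  have L: "0 \<le> L i" if "i \<in> {1..n}" for i
    using assms(3,6)[OF that] unfolding L_def bounded_clinear_def
    by (auto intro!: add_nonneg_nonneg numerical_radius_nonneg)
  have "joint_numerical_radius p n T powr p \<le> (\<Sum>i = 1..n. (1 / 2 * L i) powr p)"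
  proof (rule joint_numerical_radius_powr_le[OF assms(2)])
    fix i and x :: "'a \<times> 'b"
    assume i: "i \<in> {1..n}" and x: "norm x = 1"
    show "cmod (cinner (T i x) x) \<le> 1 / 2 * L i"
      unfolding assms(7)[OF i] L_def
      by (rule cmod_cinner_op_matrix_le[OF assms(3-6)[OF i] x])
  qed
  also have "\<dots> = (\<Sum>i = 1..n. 2 powr (- p) * L i powr p)"
    using L by (intro sum.cong refl) (simp add: powr_divide powr_minus divide_simps)
  also have "\<dots> = 2 powr (- p) * (\<Sum>i = 1..n. L i powr p)"
    by (simp add: sum_distrib_left)
  finally show "joint_numerical_radius p n T powr p \<le>
      2 powr (- p) * (\<Sum>i = 1..n.
        (numerical_radius (A i) + numerical_radius (D i)
          + sqrt ((numerical_radius (A i) - numerical_radius (D i))\<^sup>2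
                  + (onorm (B i) + onorm (C i))\<^sup>2)) powr p)"
    by (simp add: L_def)
next
  fix A' :: "'a \<Rightarrow> 'a" and B' :: "'b \<Rightarrow> 'a" and C' :: "'a \<Rightarrow> 'b" and D' :: "'b \<Rightarrow> 'b"
  assume ops: "bounded_clinear A'" "bounded_clinear B'" "bounded_clinear C'" "bounded_clinear D'"
  have "0 \<le> numerical_radius A'" "0 \<le> numerical_radius D'"
    using ops by (auto simp: bounded_clinear_def intro: numerical_radius_nonneg)
  then show "numerical_radius (op_matrix A' B' C' D') \<le>
      1 / 2 * (numerical_radius A' + numerical_radius D'
        + sqrt ((numerical_radius A' - numerical_radius D')\<^sup>2 + (onorm B' + onorm C')\<^sup>2))"
    by (intro numerical_radius_le cmod_cinner_op_matrix_le ops) auto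
qed

end
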